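(* Let $T = [0,1]$ (the real unit interval) be the semiring equipped with addition $a \oplus b = \max(a,b)$ and multiplication defined by $a \odot b = 0$ for all $a,b \in [0,1)$, with $1 \odot a = a \odot 1 = a$ for all $a \in T$. Then $T$ is porous and not austere; however, it is a Kuratowski semiring.
   Context: The additive identity (zero) of $T$ is the number $0$ and the multiplicative identity is the number $1$. An ideal of a commutative semiring $S$ (with operations $+,\cdot$) is a nonempty subset $I$ with $a+b\in I$ and $sa\in I$ for all $a,b\in I$, $s\in S$. An ideal $I$ is subtractive if $x+y\in I$ and $x\in I$ imply $y\in I$, for all $x,y\in S$. $\operatorname{Id}(S)$ is the lattice of ideals of $S$ ordered by inclusion, with least element $\{0\}$ and join $I+J=\{i+j:i\in I,j\in J\}$. $\operatorname{scl}_S(I)$ is the intersection of all subtractive ideals of $S$ containing $I$. $S$ is porous if it has an ideal that is not subtractive (equivalently, an ideal $I$ with $\operatorname{scl}_S(I)\ne I$). $S$ is austere if its only subtractive ideals are $\{0\}$ and $S$. A Kuratowski map on a join-semilattice $(P,\le)$ with least element $0$ is a function $k:P\to P$ such that for all $x,y\in P$: $x\le k(x)$; $k(k(x))=k(x)$; $k(0)=0$; $k(x\vee y)=k(x)\vee k(y)$. $S$ is Kuratowski if $\operatorname{scl}_S$ is a Kuratowski map on $\operatorname{Id}(S)$. *)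

theory Defs
  imports Complex_Main "HOL-Algebra.Ideal" "HOL-Algebra.Lattice"
begin

locale csemiring = semiring S + comm_monoid S for S (structure)

text \<open>The library's \<^locale>\<open>ideal\<close> presupposes a ring; these are ideals of semirings.\<close>

definition semiring_ideal :: "'a set \<Rightarrow> ('a, 'm) ring_scheme \<Rightarrow> bool" where
  "semiring_ideal I S \<longleftrightarrow>
     I \<subseteq> carrier S \<and> I \<noteq> {} \<and>
     (\<forall>a\<in>I. \<forall>b\<in>I. a \<oplus>\<^bsub>S\<^esub> b \<in> I) \<and>
     (\<forall>s\<in>carrier S. \<forall>a\<in>I. s \<otimes>\<^bsub>S\<^esub> a \<in> I)"

definition subtractive_ideal :: "'a set \<Rightarrow> ('a, 'm) ring_scheme \<Rightarrow> bool" where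
  "subtractive_ideal I S \<longleftrightarrow>
     semiring_ideal I S \<and>
     (\<forall>x\<in>carrier S. \<forall>y\<in>carrier S. x \<oplus>\<^bsub>S\<^esub> y \<in> I \<and> x \<in> I \<longrightarrow> y \<in> I)"

definition ideal_lattice :: "('a, 'm) ring_scheme \<Rightarrow> 'a set gorder" where
  "ideal_lattice S = \<lparr>carrier = {I. semiring_ideal I S}, eq = (=), le = (\<subseteq>)\<rparr>"

definition scl :: "('a, 'm) ring_scheme \<Rightarrow> 'a set \<Rightarrow> 'a set" where
  "scl S I = \<Inter>{J. subtractive_ideal J S \<and> I \<subseteq> J}"

definition porous :: "('a, 'm) ring_scheme \<Rightarrow> bool" where
  "porous S \<longleftrightarrow> (\<exists>I. semiring_ideal I S \<and> \<not> subtractive_ideal I S)"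

definition austere :: "('a, 'm) ring_scheme \<Rightarrow> bool" where
  "austere S \<longleftrightarrow> (\<forall>I. subtractive_ideal I S \<longrightarrow> I = {\<zero>\<^bsub>S\<^esub>} \<or> I = carrier S)"

locale kuratowski_map = upper_semilattice L + weak_partial_order_bottom L
    for L (structure) +
  fixes k
  assumes map_closed: "x \<in> carrier L \<Longrightarrow> k x \<in> carrier L"
    and extensive: "x \<in> carrier L \<Longrightarrow> x \<sqsubseteq> k x"
    and idem: "x \<in> carrier L \<Longrightarrow> k (k x) = k x"
    and map_bottom: "k \<bottom> = \<bottom>"
    and map_join: "\<lbrakk>x \<in> carrier L; y \<in> carrier L\<rbrakk> \<Longrightarrow> k (x \<squnion> y) = k x \<squnion> k y"

definition kuratowski_semiring :: "('a, 'm) ring_scheme \<Rightarrow> bool" where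
  "kuratowski_semiring S \<longleftrightarrow> kuratowski_map (ideal_lattice S) (scl S)"

definition T_semiring :: "real ring" where
  "T_semiring = \<lparr>carrier = {0..1},
        mult = (\<lambda>a b. if a = 1 then b else if b = 1 then a else 0),
        one = 1,
        zero = 0,
        add = max\<rparr>"

lemma csemiring_T_semiring: "csemiring T_semiring"
  by unfold_locales (auto simp: T_semiring_def Units_def max_def)

context csemiring
begin

lemma ideal_zero: "semiring_ideal I S \<Longrightarrow> \<zero> \<in> I"
  unfolding semiring_ideal_def by (metis all_not_in_conv l_null subsetD zero_closed)

lemma semiring_ideal_zero: "semiring_ideal {\<zero>} S"
  by (simp add: semiring_ideal_def)

lemma least_ideal_lattice: "least (ideal_lattice S) {\<zero>} (carrier (ideal_lattice S))"
  by (auto simp: least_def ideal_lattice_def semiring_ideal_zero ideal_zero)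

lemma semiring_ideal_add:
  assumes I: "semiring_ideal I S" and J: "semiring_ideal J S"
  shows "semiring_ideal (I <+>\<^bsub>S\<^esub> J) S"
  unfolding semiring_ideal_def
proof (intro conjI ballI)
  have sub: "I \<subseteq> carrier S" "J \<subseteq> carrier S"
    using I J by (auto simp: semiring_ideal_def)
  then show "I <+>\<^bsub>S\<^esub> J \<subseteq> carrier S"
    by (auto simp: set_add_def')
  show "I <+>\<^bsub>S\<^esub> J \<noteq> {}"
    using ideal_zero[OF I] ideal_zero[OF J] by (auto simp: set_add_def')
  show "a \<oplus> b \<in> I <+>\<^bsub>S\<^esub> J" if "a \<in> I <+>\<^bsub>S\<^esub> J" "b \<in> I <+>\<^bsub>S\<^esub> J" for a b
  proof -
    obtain i j i' j' where h: "i \<in> I" "j \<in> J" "i' \<in> I" "j' \<in> J" "a = i \<oplus> j" "b = i' \<oplus> j'"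
      using \<open>a \<in> I <+>\<^bsub>S\<^esub> J\<close> \<open>b \<in> I <+>\<^bsub>S\<^esub> J\<close> by (auto simp: set_add_def')
    have "i \<in> carrier S" "j \<in> carrier S" "i' \<in> carrier S" "j' \<in> carrier S"
      using h sub by auto
    then have "a \<oplus> b = (i \<oplus> i') \<oplus> (j \<oplus> j')"
      by (simp add: h a_ac)
    moreover have "i \<oplus> i' \<in> I" "j \<oplus> j' \<in> J"
      using h I J by (auto simp: semiring_ideal_def)
    ultimately show ?thesis by (auto simp: set_add_def')
  qed
  show "s \<otimes> a \<in> I <+>\<^bsub>S\<^esub> J" if s: "s \<in> carrier S" and a: "a \<in> I <+>\<^bsub>S\<^esub> J" for s a
  proof -
    obtain i j where h: "i \<in> I" "j \<in> J" "a = i \<oplus> j"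
      using a by (auto simp: set_add_def')
    have "s \<otimes> a = s \<otimes> i \<oplus> s \<otimes> j"
      using h sub s by (simp add: r_distr subsetD)
    moreover have "s \<otimes> i \<in> I" "s \<otimes> j \<in> J"
      using h I J s by (auto simp: semiring_ideal_def)
    ultimately show ?thesis by (auto simp: set_add_def')
  qed
qed

lemma least_Upper_ideal_lattice:
  assumes I: "semiring_ideal I S" and J: "semiring_ideal J S"
  shows "least (ideal_lattice S) (I <+>\<^bsub>S\<^esub> J) (Upper (ideal_lattice S) {I, J})"
proof -
  have sub: "I \<subseteq> carrier S" "J \<subseteq> carrier S"
    using I J by (auto simp: semiring_ideal_def)
  have "I \<subseteq> I <+>\<^bsub>S\<^esub> J"
  proof
    fix i assume "i \<in> I"
    then have "i = i \<oplus> \<zero>" using sub by auto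
    then show "i \<in> I <+>\<^bsub>S\<^esub> J" using \<open>i \<in> I\<close> ideal_zero[OF J] unfolding set_add_def' by blast
  qed
  moreover have "J \<subseteq> I <+>\<^bsub>S\<^esub> J"
  proof
    fix j assume "j \<in> J"
    then have "j = \<zero> \<oplus> j" using sub by auto
    then show "j \<in> I <+>\<^bsub>S\<^esub> J" using \<open>j \<in> J\<close> ideal_zero[OF I] unfolding set_add_def' by blast
  qed
  moreover have "I <+>\<^bsub>S\<^esub> J \<subseteq> K" if "semiring_ideal K S" "I \<subseteq> K" "J \<subseteq> K" for K
    using that unfolding semiring_ideal_def set_add_def' by blast
  ultimately show ?thesis
    using I J semiring_ideal_add[OF I J] by (auto simp: least_def Upper_def ideal_lattice_def)
qed

end

sublocale csemiring \<subseteq> Id: upper_semilattice "ideal_lattice S" + Id: weak_partial_order_bottom "ideal_lattice S"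
proof -
  interpret partial_order "ideal_lattice S"
    by unfold_locales (auto simp: ideal_lattice_def)
  show "upper_semilattice (ideal_lattice S)"
    by unfold_locales (use least_Upper_ideal_lattice in \<open>auto simp: ideal_lattice_def\<close>)
  show "weak_partial_order_bottom (ideal_lattice S)"
    by unfold_locales (use least_ideal_lattice in blast)
qed

lemma (in csemiring) bottom_ideal_lattice: "\<bottom>\<^bsub>ideal_lattice S\<^esub> = {\<zero>}"
  using Id.least_unique[OF Id.bottom_least least_ideal_lattice] .

lemma (in csemiring) join_ideal_lattice:
  assumes "semiring_ideal I S" "semiring_ideal J S"
  shows "I \<squnion>\<^bsub>ideal_lattice S\<^esub> J = I <+>\<^bsub>S\<^esub> J"
  using Id.least_unique[OF Id.sup_of_two_least least_Upper_ideal_lattice] assms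
  by (simp add: join_def ideal_lattice_def)

end

theory Submission
  imports Defs
begin

text \<open>
  Away from \<open>1\<close> all products vanish, so the proper ideals of \<open>T\<close> are exactly the subsets of
  \<open>[0,1)\<close> that contain \<open>0\<close>. Since \<open>max x y = x\<close> for \<open>y \<le> x\<close>, an ideal is subtractive iff it is
  closed downwards, so the subtractive closure is the downward closure. The latter commutes with
  joins because \<open>x \<le> max i j\<close> means \<open>x \<le> i\<close> or \<open>x \<le> j\<close>.
\<close>

lemma T_semiring_simps [simp]:
  "carrier T_semiring = {0..1}"
  "a \<otimes>\<^bsub>T_semiring\<^esub> b = (if a = 1 then b else if b = 1 then a else 0)"
  "\<one>\<^bsub>T_semiring\<^esub> = 1" "\<zero>\<^bsub>T_semiring\<^esub> = 0" "a \<oplus>\<^bsub>T_semiring\<^esub> b = max a b"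
  by (simp_all add: T_semiring_def)

interpretation T: csemiring T_semiring
  by (rule csemiring_T_semiring)

text \<open>Once \<open>1\<close> lies in \<open>I\<close>, every \<open>s\<close> does, being the
  multiple of \<open>1\<close> by \<open>s\<close>. Without \<open>1\<close>, multiplying an element
  of \<open>I\<close> gives that element or \<open>0\<close>, and closure under addition is
  automatic because a maximum is one of its two arguments.\<close>

lemma semiring_ideal_T_iff:
  "semiring_ideal I T_semiring \<longleftrightarrow> I = {0..1} \<or> (I \<subseteq> {0..<1} \<and> 0 \<in> I)"
proof
  assume I: "semiring_ideal I T_semiring"
  have sub: "I \<subseteq> {0..1}"
    using I by (simp add: semiring_ideal_def)
  show "I = {0..1} \<or> (I \<subseteq> {0..<1} \<and> 0 \<in> I)"
  proof (cases "1 \<in> I")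
    case True
    have "s \<in> I" if "s \<in> {0..1}" for s
    proof -
      have "s \<otimes>\<^bsub>T_semiring\<^esub> 1 \<in> I"
        using I True that unfolding semiring_ideal_def by (metis T_semiring_simps(1))
      then show ?thesis by (simp split: if_splits)
    qed
    then show ?thesis using sub by blast
  next
    case False
    then have "I \<subseteq> {0..<1}"
      using sub by (force simp: less_le)
    then show ?thesis using T.ideal_zero[OF I] by simp
  qed
next
  assume "I = {0..1} \<or> (I \<subseteq> {0..<1} \<and> 0 \<in> I)"
  then show "semiring_ideal I T_semiring"
    by (auto simp: semiring_ideal_def max_def subset_iff)
qed

lemma subtractive_ideal_T_iff:
  "subtractive_ideal I T_semiring \<longleftrightarrow>
     semiring_ideal I T_semiring \<and> (\<forall>x\<in>I. \<forall>y\<in>{0..x}. y \<in> I)"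
proof
  assume I: "subtractive_ideal I T_semiring"
  have "y \<in> I" if "x \<in> I" "y \<in> {0..x}" for x y
  proof -
    have "I \<subseteq> {0..1}"
      using I by (simp add: subtractive_ideal_def semiring_ideal_def)
    \<comment> \<open>As \<open>y\<close> lies below \<open>x\<close>, the sum
      \<open>max x y\<close> is \<open>x\<close> itself and so belongs to \<open>I\<close>;
      subtractivity then yields \<open>y\<close>.\<close>
    then have "x \<in> {0..1}" "y \<in> {0..1}" "max x y = x"
      using that by auto
    then show ?thesis
      using I \<open>x \<in> I\<close> unfolding subtractive_ideal_def T_semiring_simps by metis
  qed
  then show "semiring_ideal I T_semiring \<and> (\<forall>x\<in>I. \<forall>y\<in>{0..x}. y \<in> I)"
    using I by (simp add: subtractive_ideal_def)
next
  assume I: "semiring_ideal I T_semiring \<and> (\<forall>x\<in>I. \<forall>y\<in>{0..x}. y \<in> I)"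
  have "y \<in> I" if "y \<in> {0..1}" "max x y \<in> I" for x y
  proof -
    \<comment> \<open>Downward closure is applied at the sum \<open>max x y\<close>, which lies
      above \<open>y\<close>.\<close>
    have "y \<in> {0..max x y}" using that by simp
    then show ?thesis using I that by blast
  qed
  then show "subtractive_ideal I T_semiring"
    using I by (auto simp: subtractive_ideal_def)
qed

text \<open>Passing to smaller elements never creates \<open>1\<close>, so a proper ideal has a
  proper downward closure; it is closed downwards by transitivity.\<close>

lemma subtractive_ideal_T_downward_closure:
  assumes I: "semiring_ideal I T_semiring"
  shows "subtractive_ideal (\<Union>a\<in>I. {0..a}) T_semiring"
proof -
  have "semiring_ideal (\<Union>a\<in>I. {0..a}) T_semiring"
  proof (cases "I = {0..1}")
    case True
    then have "(\<Union>a\<in>I. {0..a}) = {0..1}" by auto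
    then show ?thesis by (simp add: semiring_ideal_T_iff)
  next
    case False
    then have "I \<subseteq> {0..<1}" "0 \<in> I"
      using I by (auto simp: semiring_ideal_T_iff)
    then have "(\<Union>a\<in>I. {0..a}) \<subseteq> {0..<1} \<and> 0 \<in> (\<Union>a\<in>I. {0..a})"
      by auto
    then show ?thesis unfolding semiring_ideal_T_iff by blast
  qed
  moreover have "y \<in> (\<Union>a\<in>I. {0..a})" if "x \<in> (\<Union>a\<in>I. {0..a})" "y \<in> {0..x}" for x y
    using that by (auto intro: order_trans)
  ultimately show ?thesis
    unfolding subtractive_ideal_T_iff by blast
qed

text \<open>The downward closure is one of the subtractive ideals being intersected, and it is
  contained in each of the others, since these are closed downwards.\<close>

lemma scl_T:
  assumes I: "semiring_ideal I T_semiring"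
  shows "scl T_semiring I = (\<Union>a\<in>I. {0..a})"
proof
  have "I \<subseteq> (\<Union>a\<in>I. {0..a})"
    using I by (force simp: semiring_ideal_def)
  then show "scl T_semiring I \<subseteq> (\<Union>a\<in>I. {0..a})"
    using subtractive_ideal_T_downward_closure[OF I] unfolding scl_def by blast
  show "(\<Union>a\<in>I. {0..a}) \<subseteq> scl T_semiring I"
    unfolding scl_def subtractive_ideal_T_iff by blast
qed

text \<open>This makes \<open>scl\<close> a map on the ideal lattice and lets the join of two
  closures be rewritten as their sum.\<close>

lemma semiring_ideal_scl_T:
  "semiring_ideal I T_semiring \<Longrightarrow> semiring_ideal (scl T_semiring I) T_semiring"
  using subtractive_ideal_T_downward_closure[of I]
  by (simp add: scl_T subtractive_ideal_def)

lemma scl_T_set_add: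
  assumes I: "semiring_ideal I T_semiring" and J: "semiring_ideal J T_semiring"
  shows "scl T_semiring (I <+>\<^bsub>T_semiring\<^esub> J) =
    scl T_semiring I <+>\<^bsub>T_semiring\<^esub> scl T_semiring J"
proof -
  have zero: "0 \<in> I" "0 \<in> J"
    using T.ideal_zero[OF I] T.ideal_zero[OF J] by simp_all
  have "x \<in> (\<Union>a\<in>I <+>\<^bsub>T_semiring\<^esub> J. {0..a}) \<longleftrightarrow>
      x \<in> (\<Union>a\<in>I. {0..a}) <+>\<^bsub>T_semiring\<^esub> (\<Union>a\<in>J. {0..a})" (is "?l \<longleftrightarrow> ?r") for x
  proof
    assume ?l
    then obtain i j where ij: "i \<in> I" "j \<in> J" "0 \<le> x" "x \<le> i \<or> x \<le> j"
      by (auto simp: set_add_def' le_max_iff_disj)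
    \<comment> \<open>The element \<open>0\<close> serves as the trivial second summand: whichever
      closure contains \<open>x\<close>, the equations \<open>x = max x 0\<close> and
      \<open>x = max 0 x\<close> place it in the sum.\<close>
    have dz: "0 \<in> (\<Union>a\<in>I. {0..a})" "0 \<in> (\<Union>a\<in>J. {0..a})"
      using zero by force+
    have "max x 0 = x" "max 0 x = x" using ij by simp_all
    moreover have "x \<in> (\<Union>a\<in>I. {0..a}) \<or> x \<in> (\<Union>a\<in>J. {0..a})"
      using ij by auto
    ultimately show ?r
      using dz unfolding set_add_def' T_semiring_simps by blast
  next
    assume ?r
    then obtain i j y z where "i \<in> I" "j \<in> J" "y \<in> {0..i}" "z \<in> {0..j}" "x = max y z"
      by (auto simp: set_add_def')
    \<comment> \<open>Monotonicity of \<open>max\<close>; the bound \<open>max i j\<close> is an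
      element of the sum of \<open>I\<close> and \<open>J\<close>.\<close>
    then have "x \<in> {0..max i j}" by auto
    then show ?l
      using \<open>i \<in> I\<close> \<open>j \<in> J\<close> by (auto simp: set_add_def')
  qed
  then show ?thesis
    by (simp add: set_eq_iff scl_T I J T.semiring_ideal_add)
qed

lemma porous_T: "porous T_semiring"
  unfolding porous_def
proof (intro exI conjI)
  \<comment> \<open>A set with a gap: \<open>1/4\<close> lies below \<open>1/2\<close> but is
    missing.\<close>
  show "semiring_ideal {0, 1/2} T_semiring"
    by (simp add: semiring_ideal_T_iff)
  have "1/4 \<in> {0..1/2::real}" "1/4 \<notin> {0, 1/2::real}" by simp_all
  then show "\<not> subtractive_ideal {0, 1/2} T_semiring"
    unfolding subtractive_ideal_T_iff by blast
qed

lemma not_austere_T: "\<not> austere T_semiring"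
proof
  assume "austere T_semiring"
  \<comment> \<open>The half-open interval is the largest proper ideal; \<open>1/2\<close> separates
    it from \<open>{0}\<close> and \<open>1\<close> from the whole carrier.\<close>
  moreover have "subtractive_ideal {0..<1} T_semiring"
    by (auto simp: subtractive_ideal_T_iff semiring_ideal_T_iff)
  ultimately have "{0..<1::real} = {0} \<or> {0..<1::real} = {0..1}"
    unfolding austere_def by simp
  moreover have "1/2 \<in> {0..<1::real}" "1/2 \<notin> {0::real}"
      "1 \<in> {0..1::real}" "1 \<notin> {0..<1::real}" by simp_all
  ultimately show False by metis
qed

lemma kuratowski_semiring_T: "kuratowski_semiring T_semiring"
  unfolding kuratowski_semiring_def
proof (intro kuratowski_map.intro kuratowski_map_axioms.intro)
  show "upper_semilattice (ideal_lattice T_semiring)"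
    by (rule T.Id.upper_semilattice_axioms)
  show "weak_partial_order_bottom (ideal_lattice T_semiring)"
    by (rule T.Id.weak_partial_order_bottom_axioms)
  show "scl T_semiring \<bottom>\<^bsub>ideal_lattice T_semiring\<^esub> = \<bottom>\<^bsub>ideal_lattice T_semiring\<^esub>"
    using scl_T[OF T.semiring_ideal_zero] by (simp add: T.bottom_ideal_lattice)
  fix I assume "I \<in> carrier (ideal_lattice T_semiring)"
  then have I: "semiring_ideal I T_semiring" by (simp add: ideal_lattice_def)
  show "scl T_semiring I \<in> carrier (ideal_lattice T_semiring)"
    using semiring_ideal_scl_T[OF I] by (simp add: ideal_lattice_def)
  show "I \<sqsubseteq>\<^bsub>ideal_lattice T_semiring\<^esub> scl T_semiring I"
    by (auto simp: ideal_lattice_def scl_def)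
  \<comment> \<open>A subtractive ideal contains \<open>I\<close> iff it contains
    \<open>scl T_semiring I\<close>, so both sides intersect the same family.\<close>
  show "scl T_semiring (scl T_semiring I) = scl T_semiring I"
    by (auto simp: scl_def)
  fix J assume "J \<in> carrier (ideal_lattice T_semiring)"
  then have J: "semiring_ideal J T_semiring" by (simp add: ideal_lattice_def)
  show "scl T_semiring (I \<squnion>\<^bsub>ideal_lattice T_semiring\<^esub> J) =
      scl T_semiring I \<squnion>\<^bsub>ideal_lattice T_semiring\<^esub> scl T_semiring J"
    by (simp add: T.join_ideal_lattice I J semiring_ideal_scl_T scl_T_set_add)
qed

theorem theorem3p11:
  shows "porous T_semiring \<and> \<not> austere T_semiring \<and> kuratowski_semiring T_semiring"
  using porous_T not_austere_T kuratowski_semiring_T by blast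

end
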